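(* Let $R=(r_1,\dots,r_m)$ and $C=(c_1,\dots,c_n)$ be positive integer vectors with $\sum_{i=1}^m r_i=\sum_{j=1}^n c_j$, and let $X^*=(x^*_{ij})$ be the typical table for the margins $(R,C)$. Let $r_+=\max_i r_i$, $r_-=\min_i r_i$, $c_+=\max_j c_j$, $c_-=\min_j c_j$. (1) We have $$x^*_{ij}\ \ge\ \frac{r_-c_-}{r_+m}\quad\text{and}\quad x^*_{ij}\ \ge\ \frac{c_-r_-}{c_+n}\quad\text{for all } i,j.$$ (2) If $r_-c_++r_-c_-+mr_->r_+c_+$, then $$x^*_{ij}\le\frac{c_+\left(r_-c_-+mr_+\right)}{m\left(r_-c_++r_-c_-+mr_--r_+c_+\right)}\quad\text{for all } i,j.$$ Similarly, if $c_-r_++c_-r_-+nc_->r_+c_+$, then $$x^*_{ij}\le\frac{r_+\left(c_-r_-+nc_+\right)}{n\left(c_-r_++c_-r_-+nc_--c_+r_+\right)}\quad\text{for all } i,j.$$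
   Context: The typical table $X^*=(x^*_{ij})$ for margins $(R,C)$ is the unique maximizer of the strictly concave function $g(X)=\sum_{ij}\left((x_{ij}+1)\ln(x_{ij}+1)-x_{ij}\ln x_{ij}\right)$ (with $0\ln0=0$) on the transportation polytope $\mathcal{P}(R,C)$ of all $m\times n$ non-negative real matrices $X=(x_{ij})$ with row sums $R$ and column sums $C$. *)

theory Defs
  imports "HOL-Analysis.Analysis"
begin

text \<open>An m by n matrix has type \<^typ>\<open>real ^ 'n ^ 'm\<close>; the entry in row i and column j
  is \<^term>\<open>X $ i $ j\<close>.\<close>

definition transportation_polytope :: "nat ^ 'm::finite \<Rightarrow> nat ^ 'n::finite \<Rightarrow> (real ^ 'n ^ 'm) set"
  where "transportation_polytope R C =
    {X. (\<forall>i j. 0 \<le> X $ i $ j) \<and>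
        (\<forall>i. (\<Sum>j\<in>UNIV. X $ i $ j) = real (R $ i)) \<and>
        (\<forall>j. (\<Sum>i\<in>UNIV. X $ i $ j) = real (C $ j))}"

text \<open>The convention 0 ln 0 = 0 needs no case distinction, since the factor 0 makes the
  product vanish.\<close>

definition table_entropy :: "real ^ 'n::finite ^ 'm::finite \<Rightarrow> real"
  where "table_entropy X =
    (\<Sum>i\<in>UNIV. \<Sum>j\<in>UNIV.
      (X $ i $ j + 1) * ln (X $ i $ j + 1) - X $ i $ j * ln (X $ i $ j))"

text \<open>The description is meaningful only when the maximizer exists and is unique,
  which is the case whenever the polytope is nonempty.\<close>

definition typical_table :: "nat ^ 'm::finite \<Rightarrow> nat ^ 'n::finite \<Rightarrow> real ^ 'n ^ 'm"
  where "typical_table R C =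
    (THE X. is_arg_max table_entropy (\<lambda>Y. Y \<in> transportation_polytope R C) X)"

end

theory Submission
  imports Defs "HOL-Real_Asymp.Real_Asymp"
begin

text \<open>
  The slope of \<open>f x = (x + 1) ln (x + 1) - x ln x\<close> is infinite at 0, so the maximizer of the
  entropy is positive: otherwise, moving it slightly towards the independence table
  \<open>r\<^sub>i c\<^sub>j / N\<close> would increase the entropy. Stationarity along the directions that preserve the
  margins then says that \<open>ln (1 + 1 / x\<^sub>i\<^sub>j)\<close> is additive, that is, \<open>1 + 1 / x\<^sub>i\<^sub>j = a\<^sub>i b\<^sub>j\<close>.

  If \<open>a\<^sub>p \<le> a\<^sub>i\<close>, the ratio \<open>x\<^sub>i\<^sub>j / x\<^sub>p\<^sub>j\<close> of two entries in the same column is the larger the larger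
  \<open>b\<^sub>j\<close> is, so at the column \<open>q\<close> with maximal \<open>b\<close> it is at least the ratio of the row sums.
  Take \<open>p\<close> and \<open>k\<close> with \<open>a\<close> minimal and maximal. The least entry of the table is \<open>x\<^sub>k\<^sub>q\<close>, and
  \<open>x\<^sub>p\<^sub>q\<close>, being the largest entry of its column, is at least the average of that column; this
  is the lower bound. For the upper bound, the lower bound on \<open>x\<^sub>k\<^sub>q\<close> and the ratio inequality
  give an upper bound on \<open>t = a\<^sub>k / a\<^sub>p\<close>. At the column \<open>s\<close> with minimal \<open>b\<close>, the entry \<open>x\<^sub>k\<^sub>s\<close> is
  at most the average of its column, and the largest entry \<open>x\<^sub>p\<^sub>s\<close> of the table is controlled by
  \<open>1 + 1 / x\<^sub>k\<^sub>s = t (1 + 1 / x\<^sub>p\<^sub>s)\<close>.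
\<close>

section \<open>Concavity and continuity of the one-variable entropy\<close>

text \<open>This is the Shannon entropy of the geometric distribution on 0, 1, 2, ... with mean
  \<open>x\<close>.\<close>

definition geom_entropy :: "real \<Rightarrow> real"
  where "geom_entropy x = (x + 1) * ln (x + 1) - x * ln x"

lemma table_entropy_eq: "table_entropy X = (\<Sum>i\<in>UNIV. \<Sum>j\<in>UNIV. geom_entropy (X $ i $ j))"
  by (simp add: table_entropy_def geom_entropy_def)

lemma ln_one_plus_inverse: "ln (1 + 1 / x) = ln (x + 1) - ln x" if "0 < x" for x :: real
proof -
  have "1 + 1 / x = (x + 1) / x"
    using that by (simp add: field_simps)
  then show ?thesis
    using that by (simp add: ln_div)
qed

text \<open>Left side minus right side is \<open>ln (z + 1) - ln (x + 1)\<close> plus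
  \<open>z\<close> times the logarithm of \<open>x * (z + 1) / (z * (x + 1))\<close>. Applying
  \<open>ln u \<le> u - 1\<close> to each gives bounds that cancel, the first one strict. The
  boundary point \<open>z = 0\<close> is included.\<close>

lemma geom_entropy_less_tangent:
  assumes x: "0 < x" and z: "0 \<le> z" and ne: "z \<noteq> x"
  shows "geom_entropy z < geom_entropy x + ln (1 + 1 / x) * (z - x)"
proof -
  have pos: "0 < (z + 1) / (x + 1)"
    using x z by simp
  have "ln ((z + 1) / (x + 1)) < (z + 1) / (x + 1) - 1"
    using ln_le_minus_one[OF pos] ln_eq_minus_one[OF pos] ne x
    by (cases "ln ((z + 1) / (x + 1)) = (z + 1) / (x + 1) - 1") (auto simp: field_simps)
  also have "\<dots> = (z - x) / (x + 1)"
    using x by (simp add: field_simps)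
  finally have 1: "ln (z + 1) - ln (x + 1) < (z - x) / (x + 1)"
    using x z by (simp add: ln_div)
  have 2: "z * (ln x + ln (z + 1) - (ln z + ln (x + 1))) \<le> - ((z - x) / (x + 1))"
  proof (cases "z = 0")
    case False
    with z have z: "0 < z" by simp
    have "ln (x * (z + 1) / (z * (x + 1))) \<le> x * (z + 1) / (z * (x + 1)) - 1"
      using x z by (intro ln_le_minus_one) simp
    then have "z * ln (x * (z + 1) / (z * (x + 1))) \<le> z * (x * (z + 1) / (z * (x + 1)) - 1)"
      using z by simp
    also have "\<dots> = x * (z + 1) / (x + 1) - z"
      using z by (simp add: right_diff_distrib)
    also have "\<dots> = - ((z - x) / (x + 1))"
      using x by (simp add: field_simps)
    finally show ?thesis
      using x z by (simp add: ln_div ln_mult)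
  qed (use x in simp)
  show ?thesis
    using 1 2 unfolding geom_entropy_def ln_one_plus_inverse[OF x] by (simp add: algebra_simps)
qed

lemma geom_entropy_le_tangent:
  assumes "0 < x" "0 \<le> z"
  shows "geom_entropy z \<le> geom_entropy x + ln (1 + 1 / x) * (z - x)"
  using geom_entropy_less_tangent[OF assms] by (cases "z = x") auto

lemma geom_entropy_mix:
  assumes "0 \<le> x" "0 < y" "0 < e" "e < 1"
  shows "(1 - e) * geom_entropy x + e * geom_entropy y \<le> geom_entropy ((1 - e) * x + e * y)"
proof -
  \<comment> \<open>Both values are compared with the tangent at the mixture \<open>w\<close>, where
    the slope terms cancel; \<open>w\<close> is positive even if \<open>x = 0\<close>.\<close>
  define w where "w = (1 - e) * x + e * y"
  have w: "0 < w"
    using assms unfolding w_def by (intro add_nonneg_pos) auto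
  have "(1 - e) * geom_entropy x \<le> (1 - e) * (geom_entropy w + ln (1 + 1 / w) * (x - w))"
    using assms w by (intro mult_left_mono geom_entropy_le_tangent) auto
  moreover have "e * geom_entropy y \<le> e * (geom_entropy w + ln (1 + 1 / w) * (y - w))"
    using assms w by (intro mult_left_mono geom_entropy_le_tangent) auto
  moreover have "(1 - e) * (geom_entropy w + ln (1 + 1 / w) * (x - w))
      + e * (geom_entropy w + ln (1 + 1 / w) * (y - w)) =
      geom_entropy w + ln (1 + 1 / w) * ((1 - e) * x + e * y - w)"
    by (simp add: algebra_simps)
  ultimately show ?thesis
    by (simp add: w_def)
qed

lemma has_real_derivative_geom_entropy:
  assumes "0 < x"
  shows "(geom_entropy has_real_derivative ln (1 + 1 / x)) (at x)"
proof -
  have "(geom_entropy has_real_derivative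
      (ln (x + 1) + (x + 1) * (1 / (x + 1)) - (ln x + x * (1 / x)))) (at x)"
    unfolding geom_entropy_def using assms by (auto intro!: derivative_eq_intros)
  moreover have "ln (x + 1) + (x + 1) * (1 / (x + 1)) - (ln x + x * (1 / x)) = ln (1 + 1 / x)"
    using assms by (simp add: ln_one_plus_inverse)
  ultimately show ?thesis
    by simp
qed

lemma continuous_on_geom_entropy: "continuous_on {0..} geom_entropy"
proof -
  have "((\<lambda>x::real. x * ln x) \<longlongrightarrow> 0) (at_right 0)"
    by real_asymp
  then have at0: "continuous (at 0 within {0..}) (\<lambda>x::real. x * ln x)"
    unfolding continuous_within by (simp add: at_within_Ici_at_right)
  have "continuous_on {0..} (\<lambda>x::real. x * ln x)"
    unfolding continuous_on_eq_continuous_within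
  proof
    fix x :: real assume "x \<in> {0..}"
    then show "continuous (at x within {0..}) (\<lambda>x. x * ln x)"
      using at0 by (cases "x = 0") (auto intro!: continuous_intros)
  qed
  moreover have "continuous_on {0..} (\<lambda>x::real. (x + 1) * ln (x + 1))"
    by (intro continuous_intros) auto
  ultimately show ?thesis
    unfolding geom_entropy_def by (intro continuous_on_diff)
qed

section \<open>Existence of an entropy maximizer\<close>

lemma compact_transportation_polytope: "compact (transportation_polytope R C)"
proof -
  have "X $ i $ j \<le> real (R $ i)" if "X \<in> transportation_polytope R C" for X i j
  proof -
    have "X $ i $ j \<le> (\<Sum>j\<in>UNIV. X $ i $ j)"
      using that by (intro member_le_sum) (auto simp: transportation_polytope_def)
    then show ?thesis
      using that by (simp add: transportation_polytope_def)
  qed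
  then have "transportation_polytope R C \<subseteq> cbox 0 (\<chi> i j. real (R $ i))"
    by (auto simp: mem_box_cart transportation_polytope_def
        Basis_vec_def inner_axis cbox_def)
  then have "bounded (transportation_polytope R C)"
    using bounded_cbox bounded_subset by blast
  moreover have "closed (transportation_polytope R C)"
    unfolding transportation_polytope_def
    by (intro closed_Collect_conj closed_Collect_all closed_Collect_le closed_Collect_eq
        continuous_intros)
  ultimately show ?thesis
    by (simp add: compact_eq_bounded_closed)
qed

lemma continuous_on_table_entropy: "continuous_on (transportation_polytope R C) table_entropy"
  unfolding table_entropy_eq
  by (intro continuous_on_sum continuous_on_compose2[OF continuous_on_geom_entropy]
      continuous_intros) (auto simp: transportation_polytope_def)

lemma independence_table_in_polytope:
  fixes R :: "nat ^ 'm::finite" and C :: "nat ^ 'n::finite"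
  assumes "(\<Sum>i\<in>UNIV. R $ i) = (\<Sum>j\<in>UNIV. C $ j)" and "0 < (\<Sum>i\<in>UNIV. R $ i)"
  shows "(\<chi> i j. real (R $ i) * real (C $ j) / real (\<Sum>i\<in>UNIV. R $ i)) \<in> transportation_polytope R C"
proof -
  have "(\<Sum>j\<in>UNIV. real (C $ j)) = real (\<Sum>i\<in>UNIV. R $ i)"
    using assms(1) by simp
  then show ?thesis
    using assms(2)
    by (auto simp: transportation_polytope_def sum_divide_distrib[symmetric]
        sum_distrib_left[symmetric] sum_distrib_right[symmetric] sum_nonneg
        simp flip: of_nat_sum)
qed

lemma exists_entropy_maximizer:
  assumes "transportation_polytope R C \<noteq> {}"
  shows "\<exists>X. is_arg_max table_entropy (\<lambda>Y. Y \<in> transportation_polytope R C) X"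
  using continuous_attains_sup[OF compact_transportation_polytope assms continuous_on_table_entropy]
  by (force simp: is_arg_max_linorder)

lemma convex_transportation_polytope: "convex (transportation_polytope R C)"
  unfolding convex_def transportation_polytope_def
  by (auto simp: sum.distrib sum_distrib_left[symmetric] distrib_right[symmetric])

section \<open>Positivity, stationarity and uniqueness of the maximizer\<close>

lemma entropy_maximizer_pos:
  assumes max: "is_arg_max table_entropy (\<lambda>Y. Y \<in> transportation_polytope R C) X"
    and Y: "Y \<in> transportation_polytope R C" and Y_pos: "\<And>i j. 0 < Y $ i $ j"
  shows "0 < X $ a $ b"
proof (rule ccontr)
  have X: "X \<in> transportation_polytope R C"
    using max by (simp add: is_arg_max_def)
  then have X_nonneg: "0 \<le> X $ i $ j" for i j
    by (simp add: transportation_polytope_def)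
  assume "\<not> 0 < X $ a $ b"
  with X_nonneg[of a b] have zero: "X $ a $ b = 0"
    by simp
  define y where "y = Y $ a $ b"
  have y: "0 < y"
    by (simp add: y_def Y_pos)
  \<comment> \<open>The right side does not depend on \<open>e\<close>, while the left side tends to
    infinity as \<open>e\<close> tends to 0 from above.\<close>
  have bound: "y * ln (1 / (e * y)) \<le> table_entropy X - table_entropy Y + geom_entropy y"
    if e: "0 < e" "e < 1" for e
  proof -
    \<comment> \<open>At \<open>(a, b)\<close>, where \<open>X\<close> vanishes, concavity is improved upon by a term of order \<open>e ln (1 / e)\<close>.\<close>
    define gap where "gap i j = geom_entropy ((1 - e) * X $ i $ j + e * Y $ i $ j)
      - ((1 - e) * geom_entropy (X $ i $ j) + e * geom_entropy (Y $ i $ j))" for i j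
    have gap_nonneg: "0 \<le> gap i j" for i j
      using geom_entropy_mix[OF X_nonneg Y_pos e] by (simp add: gap_def)
    have "e * (y * ln (1 / (e * y))) - e * geom_entropy y \<le> gap a b"
      using y e unfolding gap_def zero y_def[symmetric]
      by (simp add: geom_entropy_def ln_div algebra_simps)
    also have "gap a b \<le> (\<Sum>j\<in>UNIV. gap a j)"
      by (intro member_le_sum) (auto simp: gap_nonneg)
    also have "\<dots> \<le> (\<Sum>i\<in>UNIV. \<Sum>j\<in>UNIV. gap i j)"
      by (rule member_le_sum[where f="\<lambda>i. \<Sum>j\<in>UNIV. gap i j"])
        (auto intro!: sum_nonneg simp: gap_nonneg)
    also have "\<dots> = table_entropy ((1 - e) *\<^sub>R X + e *\<^sub>R Y)
        - ((1 - e) * table_entropy X + e * table_entropy Y)"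
      by (simp add: gap_def table_entropy_eq sum_subtractf sum.distrib sum_distrib_left)
    also have "table_entropy ((1 - e) *\<^sub>R X + e *\<^sub>R Y) \<le> table_entropy X"
      using max convexD[OF convex_transportation_polytope X Y, of "1 - e" e] e
      by (auto simp: is_arg_max_linorder)
    finally have "e * (y * ln (1 / (e * y)) - geom_entropy y)
        \<le> e * (table_entropy X - table_entropy Y)"
      by (simp add: algebra_simps)
    then show ?thesis
      using e by simp
  qed
  have "filterlim (\<lambda>e. y * ln (1 / (e * y))) at_top (at_right 0)"
    using y by real_asymp
  then have "eventually (\<lambda>e. table_entropy X - table_entropy Y + geom_entropy y
      < y * ln (1 / (e * y))) (at_right 0)"
    by (simp add: filterlim_at_top_dense)
  moreover have "eventually (\<lambda>e::real. 0 < e \<and> e < 1) (at_right 0)"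
    using eventually_at_right[of 0 "1::real"] by (auto intro: exI[of _ 1])
  ultimately have "eventually (\<lambda>e::real. False) (at_right 0)"
    by eventually_elim (use bound in force)
  then show False
    by simp
qed

text \<open>Positivity leaves room to move from \<open>X\<close> along both \<open>D\<close> and
  \<open>-D\<close>, so the entropy on this line has a local maximum at \<open>X\<close>; the sum is
  its derivative there.\<close>

lemma entropy_maximizer_stationary:
  assumes max: "is_arg_max table_entropy (\<lambda>Y. Y \<in> transportation_polytope R C) X"
    and pos: "\<And>i j. 0 < X $ i $ j"
    and rows: "\<And>i. (\<Sum>j\<in>UNIV. D $ i $ j) = 0" and cols: "\<And>j. (\<Sum>i\<in>UNIV. D $ i $ j) = 0"
  shows "(\<Sum>i\<in>UNIV. \<Sum>j\<in>UNIV. ln (1 + 1 / X $ i $ j) * D $ i $ j) = 0"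
proof -
  define \<phi> where "\<phi> t = (\<Sum>i\<in>UNIV. \<Sum>j\<in>UNIV. geom_entropy (X $ i $ j + t * D $ i $ j))" for t
  have deriv: "(\<phi> has_real_derivative (\<Sum>i\<in>UNIV. \<Sum>j\<in>UNIV. ln (1 + 1 / X $ i $ j) * D $ i $ j)) (at 0)"
    unfolding \<phi>_def
  proof (intro DERIV_sum)
    fix i j
    show "((\<lambda>t. geom_entropy (X $ i $ j + t * D $ i $ j)) has_real_derivative
        ln (1 + 1 / X $ i $ j) * D $ i $ j) (at 0)"
      using has_real_derivative_geom_entropy[OF pos[of i j]]
      by (intro DERIV_chain2[where f = geom_entropy]) (auto intro!: derivative_eq_intros)
  qed
  have "eventually (\<lambda>t. \<forall>i j. 0 < X $ i $ j + t * D $ i $ j) (nhds 0)"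
  proof (intro eventually_all_finite)
    fix i j
    have "((\<lambda>t. X $ i $ j + t * D $ i $ j) \<longlongrightarrow> X $ i $ j + 0 * D $ i $ j) (nhds 0)"
      by (intro tendsto_intros filterlim_ident)
    then show "eventually (\<lambda>t. 0 < X $ i $ j + t * D $ i $ j) (nhds 0)"
      using pos[of i j] by (intro order_tendstoD(1)) auto
  qed
  then obtain d where d: "0 < d"
    and in_d: "\<And>t i j. \<bar>t\<bar> < d \<Longrightarrow> 0 < X $ i $ j + t * D $ i $ j"
    by (auto simp: eventually_nhds_metric dist_real_def)
  have "\<phi> t \<le> \<phi> 0" if "\<bar>t\<bar> < d" for t
  proof -
    have "X + t *\<^sub>R D \<in> transportation_polytope R C"
      using max in_d[OF that]
      by (auto simp: is_arg_max_def transportation_polytope_def sum.distrib rows cols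
          sum_distrib_left[symmetric] less_imp_le)
    then have "table_entropy (X + t *\<^sub>R D) \<le> table_entropy X"
      using max by (auto simp: is_arg_max_linorder)
    then show ?thesis
      by (simp add: \<phi>_def table_entropy_eq)
  qed
  then show ?thesis
    using DERIV_local_max[OF deriv d] by simp
qed

text \<open>The tangents at the entries of \<open>X\<close> bound the entropy of \<open>Z\<close>,
  strictly at an entry where the tables differ. By stationarity in direction \<open>Z - X\<close>
  the slope terms sum to 0, so the bound is the entropy of \<open>X\<close>.\<close>

lemma entropy_maximizer_unique:
  assumes max: "is_arg_max table_entropy (\<lambda>Y. Y \<in> transportation_polytope R C) X"
    and pos: "\<And>i j. 0 < X $ i $ j"
    and max': "is_arg_max table_entropy (\<lambda>Y. Y \<in> transportation_polytope R C) Z"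
  shows "Z = X"
proof (rule ccontr)
  have X: "X \<in> transportation_polytope R C" and Z: "Z \<in> transportation_polytope R C"
    using max max' by (auto simp: is_arg_max_def)
  have Z_nonneg: "0 \<le> Z $ i $ j" for i j
    using Z by (simp add: transportation_polytope_def)
  define T where "T i j = geom_entropy (X $ i $ j) + ln (1 + 1 / X $ i $ j) * (Z $ i $ j - X $ i $ j)" for i j
  assume "Z \<noteq> X"
  then obtain a b where ab: "Z $ a $ b \<noteq> X $ a $ b"
    by (metis vec_eq_iff)
  have le: "geom_entropy (Z $ i $ j) \<le> T i j" for i j
    unfolding T_def by (intro geom_entropy_le_tangent pos Z_nonneg)
  have less: "geom_entropy (Z $ a $ b) < T a b"
    unfolding T_def by (intro geom_entropy_less_tangent pos Z_nonneg ab)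
  have "(\<Sum>j\<in>UNIV. geom_entropy (Z $ a $ j)) < (\<Sum>j\<in>UNIV. T a j)"
    using le less by (intro sum_strict_mono_ex1) auto
  then have "table_entropy Z < (\<Sum>i\<in>UNIV. \<Sum>j\<in>UNIV. T i j)"
    unfolding table_entropy_eq by (intro sum_strict_mono_ex1) (auto intro: sum_mono le)
  also have "\<dots> = table_entropy X"
    using entropy_maximizer_stationary[OF max pos, where D = "Z - X"] X Z
    by (simp add: T_def table_entropy_eq sum.distrib transportation_polytope_def sum_subtractf)
  finally show False
    using max' X by (auto simp: is_arg_max_linorder not_less[symmetric])
qed

lemma typical_table_stationary:
  fixes R :: "nat ^ 'm::finite" and C :: "nat ^ 'n::finite"
  assumes "\<And>i. R $ i > 0" "\<And>j. C $ j > 0" "(\<Sum>i\<in>UNIV. R $ i) = (\<Sum>j\<in>UNIV. C $ j)"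
  shows "typical_table R C \<in> transportation_polytope R C"
    and "0 < typical_table R C $ i $ j"
    and "\<exists>a b. (\<forall>i. 0 < a i) \<and> (\<forall>j. 0 < b j) \<and>
      (\<forall>i j. 1 + 1 / typical_table R C $ i $ j = a i * b j)"
proof -
  define Y :: "real ^ 'n ^ 'm"
    where "Y = (\<chi> i j. real (R $ i) * real (C $ j) / real (\<Sum>i\<in>UNIV. R $ i))"
  have total: "0 < (\<Sum>i\<in>UNIV. R $ i)"
    using assms(1) by (intro sum_pos) auto
  have Y: "Y \<in> transportation_polytope R C"
    unfolding Y_def by (intro independence_table_in_polytope assms total)
  have Y_pos: "0 < Y $ i $ j" for i j
    using total assms by (simp add: Y_def del: of_nat_sum)
  obtain X where max: "is_arg_max table_entropy (\<lambda>Y. Y \<in> transportation_polytope R C) X"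
    using exists_entropy_maximizer Y by blast
  have pos: "0 < X $ i $ j" for i j
    by (rule entropy_maximizer_pos[OF max Y Y_pos])
  have eq: "typical_table R C = X"
    unfolding typical_table_def using max entropy_maximizer_unique[OF max pos]
    by (intro the_equality)
  show "typical_table R C \<in> transportation_polytope R C"
    using max by (simp add: eq is_arg_max_def)
  show "0 < typical_table R C $ i $ j"
    by (simp add: eq pos)
  define l where "l i j = ln (1 + 1 / X $ i $ j)" for i j
  have additive: "l i j + l p q = l i q + l p j" for i j p q
  proof -
    \<comment> \<open>The outer product of \<open>u\<close> and \<open>v\<close> is the elementary
      margin-preserving move: +1 at \<open>(i, j)\<close> and \<open>(p, q)\<close>, -1 at
      \<open>(i, q)\<close> and \<open>(p, j)\<close>.\<close>
    define u where "u k = (of_bool (k = i) - of_bool (k = p) :: real)" for k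
    define v where "v k = (of_bool (k = j) - of_bool (k = q) :: real)" for k
    have sums: "(\<Sum>k\<in>UNIV. f k * u k) = f i - f p" "(\<Sum>k\<in>UNIV. g k * v k) = g j - g q" for f g
      by (simp_all add: u_def v_def right_diff_distrib sum_subtractf of_bool_def
          if_distrib[where f = "\<lambda>x. _ * x"] cong: if_cong)
    have "(\<Sum>i\<in>UNIV. \<Sum>j\<in>UNIV. l i j * (\<chi> i j. u i * v j) $ i $ j) = 0"
      unfolding l_def
    proof (rule entropy_maximizer_stationary[OF max pos])
      show "(\<Sum>j\<in>UNIV. (\<chi> i j. u i * v j) $ i $ j) = 0" for i
        using sums(2)[of "\<lambda>_. u i"] by simp
      show "(\<Sum>i\<in>UNIV. (\<chi> i j. u i * v j) $ i $ j) = 0" for j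
        using sums(1)[of "\<lambda>_. v j"] by (simp add: mult.commute)
    qed
    also have "(\<Sum>i\<in>UNIV. \<Sum>j\<in>UNIV. l i j * (\<chi> i j. u i * v j) $ i $ j) =
        (\<Sum>i\<in>UNIV. (\<Sum>j\<in>UNIV. l i j * v j) * u i)"
      by (simp add: sum_distrib_left sum_distrib_right ac_simps)
    also have "\<dots> = l i j - l i q - (l p j - l p q)"
      by (simp add: sums)
    finally show ?thesis
      by simp
  qed
  \<comment> \<open>Any base row and column will do; \<open>undefined\<close> merely names an
    element of each index type.\<close>
  define i0 :: 'm where "i0 = undefined"
  define j0 :: 'n where "j0 = undefined"
  have "1 + 1 / X $ i $ j = exp (l i j0) * exp (l i0 j - l i0 j0)" for i j
  proof -
    have "1 + 1 / X $ i $ j = exp (l i j)"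
      using pos[of i j] by (simp add: l_def add_pos_pos)
    also have "l i j = l i j0 + (l i0 j - l i0 j0)"
      using additive[of i j i0 j0] by simp
    finally show ?thesis
      by (simp add: exp_add)
  qed
  then show "\<exists>a b. (\<forall>i. 0 < a i) \<and> (\<forall>j. 0 < b j) \<and>
      (\<forall>i j. 1 + 1 / typical_table R C $ i $ j = a i * b j)"
    unfolding eq by (intro exI[of _ "\<lambda>i. exp (l i j0)"] exI[of _ "\<lambda>j. exp (l i0 j - l i0 j0)"]) auto
qed

section \<open>Bounds for tables in product form\<close>

lemma ex_max_finite: "\<exists>k. \<forall>i. f i \<le> f k" for f :: "'a::finite \<Rightarrow> 'b::linorder"
proof -
  have "Max (range f) \<in> range f"
    by (intro Max_in) auto
  then obtain k where "Max (range f) = f k"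
    by (rule rangeE)
  then have "f i \<le> f k" for i
    using Max_ge[of "range f" "f i"] by simp
  then show ?thesis
    by blast
qed

lemma ex_min_finite: "\<exists>k. \<forall>i. f k \<le> f i" for f :: "'a::finite \<Rightarrow> 'b::linorder"
proof -
  have "Min (range f) \<in> range f"
    by (intro Min_in) auto
  then obtain k where "Min (range f) = f k"
    by (rule rangeE)
  then have "f k \<le> f i" for i
    using Min_le[of "range f" "f i"] by simp
  then show ?thesis
    by blast
qed

text \<open>The assumptions are symmetric under exchanging rows and columns, so each bound is proved
  once and \<open>transposed\<close> yields its counterpart.\<close>

locale balanced_table =
  fixes x :: "'a::finite \<Rightarrow> 'b::finite \<Rightarrow> real" and a :: "'a \<Rightarrow> real" and b :: "'b \<Rightarrow> real"
    and rmin rmax cmin cmax :: real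
  assumes x_pos: "0 < x i j" and a_pos: "0 < a i" and b_pos: "0 < b j"
    and factor: "1 + 1 / x i j = a i * b j"
    and row_ge: "rmin \<le> (\<Sum>j\<in>UNIV. x i j)" and row_le: "(\<Sum>j\<in>UNIV. x i j) \<le> rmax"
    and col_ge: "cmin \<le> (\<Sum>i\<in>UNIV. x i j)" and col_le: "(\<Sum>i\<in>UNIV. x i j) \<le> cmax"
    and rmin_pos: "0 < rmin" and cmin_pos: "0 < cmin"
begin

lemma transposed: "balanced_table (\<lambda>j i. x i j) b a cmin cmax rmin rmax"
  by unfold_locales
    (use x_pos a_pos b_pos factor row_ge row_le col_ge col_le rmin_pos cmin_pos
      in \<open>simp_all add: mult.commute\<close>)

lemma rmax_pos: "0 < rmax"
  using rmin_pos row_ge row_le by (meson less_le_trans)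

lemma cmax_pos: "0 < cmax"
  using cmin_pos col_ge col_le by (meson less_le_trans)

lemma entry_mono:
  assumes "a i \<le> a p" "b j \<le> b q"
  shows "x p q \<le> x i j"
proof -
  have "1 + 1 / x i j \<le> 1 + 1 / x p q"
    unfolding factor using assms a_pos b_pos by (intro mult_mono) (auto simp: less_imp_le)
  then show ?thesis
    using x_pos[of i j] x_pos[of p q] by (simp add: field_simps)
qed

lemma row_ratio:
  assumes "a p \<le> a i" "\<And>j. b j \<le> b q"
  shows "rmin * x p q \<le> rmax * x i q"
proof -
  have ratio: "x i j * x p q \<le> x i q * x p j" for j
  proof -
    have eqs: "1 + 1 / x i q = a i * b q" "1 + 1 / x p q = a p * b q"
      "1 + 1 / x i j = a i * b j" "1 + 1 / x p j = a p * b j"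
      by (rule factor)+
    \<comment> \<open>Two pairs of factors \<open>1 + 1 / x\<close> have the same product
      \<open>a i * a p * b q * b j\<close>. The pair whose reciprocals have the larger sum must have
      the smaller product of reciprocals.\<close>
    have "0 \<le> (a i - a p) * (b q - b j)"
      using assms by simp
    also have "\<dots> = (a i * b q) - a p * b q - a i * b j + a p * b j"
      by (simp add: algebra_simps)
    also have "\<dots> = 1 / x i q - 1 / x p q - 1 / x i j + 1 / x p j"
      unfolding eqs[symmetric] by simp
    finally have 1: "1 / x p q + 1 / x i j \<le> 1 / x i q + 1 / x p j"
      by simp
    have "(1 + 1 / x i q) * (1 + 1 / x p j) = (1 + 1 / x p q) * (1 + 1 / x i j)"
      unfolding eqs by simp
    with 1 have "1 / (x i q * x p j) \<le> 1 / (x p q * x i j)"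
      by (simp add: algebra_simps)
    then show ?thesis
      using x_pos by (simp add: divide_simps mult.commute)
  qed
  have "rmin * x p q \<le> (\<Sum>j\<in>UNIV. x i j) * x p q"
    using x_pos by (intro mult_right_mono row_ge) (simp add: less_imp_le)
  also have "\<dots> \<le> x i q * (\<Sum>j\<in>UNIV. x p j)"
    by (simp add: sum_distrib_left sum_distrib_right sum_mono ratio)
  also have "\<dots> \<le> x i q * rmax"
    using x_pos by (intro mult_left_mono row_le) (simp add: less_imp_le)
  finally show ?thesis
    by (simp add: mult.commute)
qed

lemma entry_ge: "rmin * cmin / (rmax * real CARD('a)) \<le> x i j"
proof -
  obtain k where k: "\<And>i. a i \<le> a k"
    using ex_max_finite[of a] by auto
  obtain p where p: "\<And>i. a p \<le> a i"
    using ex_min_finite[of a] by auto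
  obtain q where q: "\<And>j. b j \<le> b q"
    using ex_max_finite[of b] by auto
  have "cmin \<le> (\<Sum>i\<in>UNIV. x i q)"
    by (rule col_ge)
  also have "\<dots> \<le> real CARD('a) * x p q"
    by (intro sum_bounded_above entry_mono p order_refl)
  finally have "rmin * cmin \<le> rmin * (real CARD('a) * x p q)"
    using rmin_pos by simp
  also have "\<dots> \<le> real CARD('a) * (rmax * x k q)"
    using row_ratio[OF k[of p] q] by (simp add: mult.left_commute)
  also have "\<dots> \<le> real CARD('a) * (rmax * x i j)"
    using entry_mono[OF k q] rmax_pos by simp
  finally show ?thesis
    using rmax_pos by (simp add: divide_simps ac_simps)
qed

lemma entry_le:
  defines "m \<equiv> real CARD('a)"
  assumes cond: "rmax * cmax < rmin * cmax + rmin * cmin + m * rmin"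
  shows "x i j \<le> cmax * (rmin * cmin + m * rmax) /
    (m * (rmin * cmax + rmin * cmin + m * rmin - rmax * cmax))"
proof -
  obtain k where k: "\<And>i. a i \<le> a k"
    using ex_max_finite[of a] by auto
  obtain p where p: "\<And>i. a p \<le> a i"
    using ex_min_finite[of a] by auto
  obtain q where q: "\<And>j. b j \<le> b q"
    using ex_max_finite[of b] by auto
  obtain s where s: "\<And>j. b s \<le> b j"
    using ex_min_finite[of b] by auto
  have m: "0 < m" by (simp add: m_def)
  have "m * x k s \<le> (\<Sum>i\<in>UNIV. x i s)"
    unfolding m_def by (intro sum_bounded_below entry_mono k order_refl)
  also have "\<dots> \<le> cmax"
    by (rule col_le)
  finally have small: "m * x k s \<le> cmax" .
  have L: "rmin * cmin \<le> rmax * m * x k q"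
    using entry_ge[of k q] rmax_pos m by (simp add: m_def divide_simps ac_simps)
  have ratio: "rmin * x p q \<le> rmax * x k q"
    by (rule row_ratio[OF k q])
  define t where "t = a k / a p"
  have t: "1 \<le> t"
    using k[of p] a_pos by (simp add: t_def)
  have scale: "1 + 1 / x k j = t * (1 + 1 / x p j)" for j
    using a_pos[of p] by (simp add: factor t_def)
  \<comment> \<open>Eliminating \<open>x p q\<close> between \<open>ratio\<close> and
    \<open>scale\<close> bounds \<open>t\<close> in terms of \<open>x k q\<close> alone.\<close>
  have "t * (rmax * x k q + rmin) \<le> rmax * (x k q + 1)"
  proof -
    have "rmin \<le> rmax * x k q / x p q"
      using ratio x_pos by (simp add: pos_le_divide_eq)
    then have "t * (rmax * x k q + rmin) \<le> t * (rmax * x k q + rmax * x k q / x p q)"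
      using t by simp
    also have "\<dots> = rmax * x k q * (t * (1 + 1 / x p q))"
      by (simp add: algebra_simps)
    also have "\<dots> = rmax * (x k q + 1)"
      using x_pos[of k q] by (simp add: scale[symmetric] field_simps)
    finally show ?thesis .
  qed
  \<comment> \<open>With \<open>x k q\<close> isolated next to the factor
    \<open>t - 1 \<ge> 0\<close>, its lower bound \<open>L\<close> can be substituted.\<close>
  then have "m * ((t - 1) * (rmax * x k q)) \<le> m * (rmax - t * rmin)"
    using m by (intro mult_left_mono) (auto simp: algebra_simps)
  moreover have "(t - 1) * (rmin * cmin) \<le> (t - 1) * (rmax * m * x k q)"
    using t L by (intro mult_left_mono) auto
  ultimately have t_le: "t * (rmin * m + rmin * cmin) \<le> rmin * cmin + m * rmax"
    by (simp add: algebra_simps)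
  have "(cmax + m) * x k s \<le> cmax * (x k s + 1)"
    using small by (simp add: algebra_simps)
  then have "cmax + m \<le> cmax * (1 + 1 / x k s)"
    using x_pos[of k s] by (simp add: field_simps)
  also have "\<dots> = t * (cmax * (1 + 1 / x p s))"
    by (simp add: scale)
  finally have "(rmin * m + rmin * cmin) * (cmax + m)
      \<le> (rmin * m + rmin * cmin) * (t * (cmax * (1 + 1 / x p s)))"
    using rmin_pos cmin_pos m by (intro mult_left_mono) auto
  also have "\<dots> = t * (rmin * m + rmin * cmin) * (cmax * (1 + 1 / x p s))"
    by simp
  also have "\<dots> \<le> (rmin * cmin + m * rmax) * (cmax * (1 + 1 / x p s))"
    using t_le cmax_pos x_pos[of p s] by (intro mult_right_mono) auto
  \<comment> \<open>After expansion the terms \<open>rmin * cmin * cmax\<close> cancel. The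
    remaining factor on the left is positive by \<open>cond\<close>, which allows solving for
    \<open>x p s\<close>.\<close>
  finally have "m * (rmin * cmax + rmin * cmin + m * rmin - rmax * cmax)
      \<le> cmax * (rmin * cmin + m * rmax) / x p s"
    by (simp add: algebra_simps add_divide_distrib)
  then have "x p s \<le> cmax * (rmin * cmin + m * rmax) /
      (m * (rmin * cmax + rmin * cmin + m * rmin - rmax * cmax))"
    using x_pos[of p s] m cond by (simp add: pos_le_divide_eq mult.commute)
  then show ?thesis
    using entry_mono[OF p s, of i j] by linarith
qed

end

theorem theorem3p5:
  fixes R :: "nat ^ 'm::finite" and C :: "nat ^ 'n::finite"
    and m n r_max r_min c_max c_min :: real
  assumes "\<And>i. R $ i > 0" and "\<And>j. C $ j > 0"
    and "(\<Sum>i\<in>UNIV. R $ i) = (\<Sum>j\<in>UNIV. C $ j)"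
    and "m = real CARD('m)" and "n = real CARD('n)"
    and "r_max = real (MAX i. R $ i)" and "r_min = real (MIN i. R $ i)"
    and "c_max = real (MAX j. C $ j)" and "c_min = real (MIN j. C $ j)"
  shows "(\<forall>i j. typical_table R C $ i $ j \<ge> r_min * c_min / (r_max * m) \<and>
                typical_table R C $ i $ j \<ge> c_min * r_min / (c_max * n)) \<and>
    (r_min * c_max + r_min * c_min + m * r_min > r_max * c_max \<longrightarrow>
      (\<forall>i j. typical_table R C $ i $ j \<le>
         c_max * (r_min * c_min + m * r_max) /
         (m * (r_min * c_max + r_min * c_min + m * r_min - r_max * c_max)))) \<and>
    (c_min * r_max + c_min * r_min + n * c_min > r_max * c_max \<longrightarrow>
      (\<forall>i j. typical_table R C $ i $ j \<le>
         r_max * (c_min * r_min + n * c_max) /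
         (n * (c_min * r_max + c_min * r_min + n * c_min - c_max * r_max))))"
proof -
  let ?x = "typical_table R C"
  note table = typical_table_stationary[OF assms(1-3)]
  obtain a b where ab: "\<And>i. 0 < a i" "\<And>j. 0 < b j" "\<And>i j. 1 + 1 / ?x $ i $ j = a i * b j"
    using table(3) by blast
  have margins: "(\<Sum>j\<in>UNIV. ?x $ i $ j) = real (R $ i)" "(\<Sum>i\<in>UNIV. ?x $ i $ j) = real (C $ j)" for i j
    using table(1) by (auto simp: transportation_polytope_def)
  interpret rows: balanced_table "\<lambda>i j. ?x $ i $ j" a b r_min r_max c_min c_max
    by unfold_locales (use assms(1,2) in \<open>auto simp: margins ab table(2) assms(6-9)\<close>)
  \<comment> \<open>The second bound of each pair is the first one for the transposed table.\<close>
  interpret cols: balanced_table "\<lambda>j i. ?x $ i $ j" b a c_min c_max r_min r_max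
    by (rule rows.transposed)
  show ?thesis
    using rows.entry_ge rows.entry_le cols.entry_ge cols.entry_le
    by (auto simp: assms(4,5) mult.commute[of c_max r_max])
qed

end
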